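(* Let $\alpha,\beta,\gamma$ be positive irrational numbers with $\alpha+\beta+\gamma=1$, $\beta<1/2$, $\alpha<\gamma$, such that $1,\alpha,\beta$ are linearly independent over $\mathbb{Q}$, and in addition $\alpha>1/3$ and $\gamma<1/2$. Let $W_\alpha=(a(n))$, $W_\beta=(b(n))$, $W_\gamma=(c(n))$ be the Webster sequences $a(n)=\lceil (n-1/2)/\alpha\rceil$, $b(n)=\lceil (n-1/2)/\beta\rceil$, $c(n)=\lceil (n-1/2)/\gamma\rceil$. Then there do not exist strictly increasing sequences $(\widetilde{b}(n))_{n\in\mathbb{N}}$ and $(\widetilde{c}(n))_{n\in\mathbb{N}}$ of positive integers such that $W_\alpha$, $\{\widetilde{b}(n):n\in\mathbb{N}\}$, $\{\widetilde{c}(n):n\in\mathbb{N}\}$ partition $\mathbb{N}$, $\widetilde{c}(n)-c(n)\in\{-1,0,1\}$ for all $n$, and either $\widetilde{b}(n)-b(n)\in\{-1,0\}$ for all $n$ or $\widetilde{b}(n)-b(n)\in\{0,1\}$ for all $n$.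
   Context: $\mathbb{N}=\{1,2,3,\dots\}$. *)

theory Defs
  imports "HOL-Analysis.Analysis"
begin

text \<open>
  The reals as a vector space over the rationals. Note that \<open>rat_vs.independent\<close> speaks about a
  set: it is linear independence of a list of reals only if the list has no repetitions.
\<close>

interpretation rat_vs: vector_space "\<lambda>(q::rat) (x::real). of_rat q * x"
  by unfold_locales (simp_all add: algebra_simps of_rat_add of_rat_mult)

text \<open>Sequences over the positive integers are functions on \<^typ>\<open>nat\<close> whose value at \<open>0\<close> is junk.\<close>

definition webster :: "real \<Rightarrow> nat \<Rightarrow> int" where
  "webster \<alpha> n = \<lceil>(real n - 1/2) / \<alpha>\<rceil>"

definition seq_set :: "(nat \<Rightarrow> int) \<Rightarrow> int set" where
  "seq_set f = f ` {1..}"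

definition increasing_pos_seq :: "(nat \<Rightarrow> int) \<Rightarrow> bool" where
  "increasing_pos_seq f \<longleftrightarrow> strict_mono_on {1..} f \<and> (\<forall>n\<ge>1. f n > 0)"

text \<open>Stated for three sets rather than for a family \<open>{A, B, C}\<close>, in which equal sets would collapse.\<close>

definition partition3 :: "int set \<Rightarrow> int set \<Rightarrow> int set \<Rightarrow> bool" where
  "partition3 A B C \<longleftrightarrow>
     A \<union> B \<union> C = {1..} \<and> A \<inter> B = {} \<and> A \<inter> C = {} \<and> B \<inter> C = {}"

end

theory Submission
  imports Defs
begin

text \<open>
  Write \<open>A\<close>, \<open>B\<close>, \<open>C\<close> for the counting functions of the three Webster sequences,
  so \<open>A m = \<lfloor>\<alpha> m + 1/2\<rfloor>\<close> and so on, and \<open>B'\<close>, \<open>C'\<close> for those of the two perturbed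
  sequences; the partition forces \<open>A m + B' m + C' m = m\<close>. The three numbers \<open>\<alpha> m + 1/2\<close>,
  \<open>\<beta> m + 1/2\<close>, \<open>\<gamma> m + 1/2\<close> add up to \<open>m + 3/2\<close>. By Kronecker's theorem the first two can be
  chosen just above integers, and then the third lies just below an integer plus \<open>1/2\<close>. As
  \<open>\<gamma> < 1/2\<close>, this gives \<open>C (m - 1) = C m\<close> and \<open>A m + B m + C (m - 1) = m + 1\<close>, which is
  impossible if \<open>b'\<close> never exceeds \<open>b\<close> and \<open>c'\<close> exceeds \<open>c\<close> by at most \<open>1\<close>. Choosing the
  first two just below integers instead gives \<open>A m + B m + C (m + 1) = m - 1\<close>, which rules
  out \<open>b' \<ge> b\<close> and \<open>c' \<ge> c - 1\<close>.
\<close>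

text \<open>Kronecker's theorem gives a multiplier \<open>k\<close> of unknown sign. A simultaneous
  Dirichlet denominator \<open>q\<close> brings every \<open>q * \<theta> i\<close> close to an
  integer, so adding a large multiple of \<open>q\<close> to \<open>k\<close> makes it positive and
  hardly moves the fractional parts.\<close>

lemma Kronecker_thm_2_pos:
  fixes \<alpha> \<theta> :: "nat \<Rightarrow> real" and n :: nat
  assumes indp: "module.independent (\<lambda>r x. of_int r * x) (\<theta> ` {..n})"
    and inj: "inj_on \<theta> {..n}" and one: "\<theta> n = 1" and \<epsilon>: "\<epsilon> > 0"
  obtains k m where "k > 0" "\<And>i. i < n \<Longrightarrow> \<bar>of_int k * \<theta> i - of_int (m i) - \<alpha> i\<bar> < \<epsilon>"
proof -
  from \<epsilon> have "\<epsilon>/2 > 0" by simp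
  from Kronecker_thm_2 [OF indp inj one this, of \<alpha>] obtain k m
    where k: "\<And>i. i < n \<Longrightarrow> \<bar>of_int k * \<theta> i - of_int (m i) - \<alpha> i\<bar> < \<epsilon>/2"
    by auto
  \<comment> \<open>As \<open>q\<close> will be at least 1, this \<open>s\<close> ensures
    \<open>k + s * q > 0\<close>. It is fixed before \<open>q\<close>, so \<open>N\<close> can be
    taken large enough that the extra error \<open>s / N\<close> stays below
    \<open>\<epsilon>/2\<close>.\<close>
  define s where "s = \<bar>k\<bar> + 1"
  have s: "s > 0" by (simp add: s_def)
  obtain N :: nat where N: "real_of_int s / (\<epsilon>/2) < real N"
    using reals_Archimedean2 by blast
  have "real_of_int s / (\<epsilon>/2) > 0" using s \<epsilon> by simp
  with N have N0: "N > 0" by (metis of_nat_0_less_iff order.strict_trans)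
  obtain q p where q: "0 < q" and qp: "\<And>i. i < n \<Longrightarrow> \<bar>of_int q * \<theta> i - of_int (p i)\<bar> < 1/N"
    using Dirichlet_approx_simult [OF N0] by metis
  show thesis
  proof (rule that)
    have "s * 1 \<le> s * q" using q s by (intro mult_left_mono) auto
    moreover have "k + s > 0" by (simp add: s_def)
    ultimately show "k + s * q > 0" by simp
  next
    fix i assume i: "i < n"
    have "\<bar>of_int s * (of_int q * \<theta> i - of_int (p i))\<bar> \<le> of_int s * (1/N)"
      using qp [OF i] s by (simp only: abs_mult) (intro mult_mono, auto)
    also have "\<dots> < \<epsilon>/2" using N N0 \<epsilon> by (simp add: field_simps)
    finally have "\<bar>of_int s * (of_int q * \<theta> i - of_int (p i))\<bar> < \<epsilon>/2" .
    moreover have "of_int (k + s * q) * \<theta> i - of_int (m i + s * p i) - \<alpha> i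
        = (of_int k * \<theta> i - of_int (m i) - \<alpha> i) + of_int s * (of_int q * \<theta> i - of_int (p i))"
      by (simp add: algebra_simps)
    ultimately show "\<bar>of_int (k + s * q) * \<theta> i - of_int (m i + s * p i) - \<alpha> i\<bar> < \<epsilon>"
      using k [OF i] by linarith
  qed
qed

text \<open>Kronecker's theorem asks for independence over the integers, and an integer relation is
  in particular a rational one.\<close>

lemma rat_independent_imp_int_independent:
  fixes S :: "real set"
  assumes "rat_vs.independent S"
  shows "module.independent (\<lambda>r x. of_int r * x) S"
proof -
  interpret Z: Modules.module "\<lambda>r x. real_of_int r * x"
    by unfold_locales (simp_all add: algebra_simps)
  show ?thesis
    unfolding Z.independent_explicit_module
  proof (intro allI impI)
    fix t and u :: "real \<Rightarrow> int" and v
    assume "finite t" "t \<subseteq> S" "(\<Sum>v\<in>t. real_of_int (u v) * v) = 0" "v \<in> t"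
    then have "(of_int (u v) :: rat) = 0"
      using rat_vs.independentD [OF assms, of t "\<lambda>v. of_int (u v)" v] by simp
    then show "u v = 0" by simp
  qed
qed

lemma Kronecker_pair_pos:
  fixes \<alpha> \<beta> :: real
  assumes "distinct [1, \<alpha>, \<beta>]" "rat_vs.independent {1, \<alpha>, \<beta>}" "\<epsilon> > 0"
  obtains k :: nat and p q :: int
    where "k > 0" "\<bar>\<alpha> * k - p - x\<bar> < \<epsilon>" "\<bar>\<beta> * k - q - y\<bar> < \<epsilon>"
proof -
  \<comment> \<open>The entry 1 goes last, at index 2, where Kronecker's theorem expects it.\<close>
  define \<theta> where "\<theta> = (\<lambda>i::nat. if i = 0 then \<alpha> else if i = 1 then \<beta> else 1)"
  have le2: "{..2::nat} = {0, 1, 2}" by auto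
  have "\<theta> ` {..2} = {1, \<alpha>, \<beta>}" by (auto simp: le2 \<theta>_def)
  then have ind: "module.independent (\<lambda>r x. of_int r * x) (\<theta> ` {..2})"
    using rat_independent_imp_int_independent [OF assms(2)] by simp
  have inj: "inj_on \<theta> {..2}" using assms(1) by (auto simp: le2 \<theta>_def)
  have one: "\<theta> 2 = 1" by (simp add: \<theta>_def)
  obtain k m where k: "k > 0"
    and m: "\<And>i. i < 2 \<Longrightarrow> \<bar>of_int k * \<theta> i - of_int (m i) - (if i = 0 then x else y)\<bar> < \<epsilon>"
    using Kronecker_thm_2_pos [OF ind inj one assms(3), of "\<lambda>i. if i = 0 then x else y"] by metis
  show thesis
    using that [of "nat k" "m 0" "m 1"] k m [of 0] m [of 1] by (simp add: \<theta>_def mult.commute)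
qed

text \<open>Indices are counted rather than values, so that termwise bounds between two sequences
  become inclusions of index sets.\<close>

definition seq_count :: "(nat \<Rightarrow> int) \<Rightarrow> int \<Rightarrow> nat" where
  "seq_count f m = card {n. n \<ge> 1 \<and> f n \<le> m}"

lemma increasing_pos_seq_ge:
  assumes "increasing_pos_seq f" "n \<ge> 1"
  shows "int n \<le> f n"
  using \<open>n \<ge> 1\<close>
proof (induction n rule: dec_induct)
  case base
  then show ?case using assms(1) by (force simp: increasing_pos_seq_def)
next
  case (step n)
  then have "f n < f (Suc n)"
    using assms(1) by (auto simp: increasing_pos_seq_def strict_mono_on_def)
  with step show ?case by simp
qed

lemma finite_seq_count:
  assumes "increasing_pos_seq f"
  shows "finite {n. n \<ge> 1 \<and> f n \<le> m}"
proof (rule finite_subset)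
  show "{n. n \<ge> 1 \<and> f n \<le> m} \<subseteq> {..nat m}"
  proof
    fix n assume "n \<in> {n. n \<ge> 1 \<and> f n \<le> m}"
    with increasing_pos_seq_ge [OF assms, of n] show "n \<in> {..nat m}" by auto
  qed
qed simp

text \<open>Two separate bounds \<open>k\<close> and \<open>m\<close> are allowed so that a
  displacement of terms by 1 can be traded for a shift of the bound by 1.\<close>

lemma seq_count_mono:
  assumes "increasing_pos_seq g" "\<And>n. n \<ge> 1 \<Longrightarrow> f n \<le> k \<Longrightarrow> g n \<le> m"
  shows "seq_count f k \<le> seq_count g m"
  unfolding seq_count_def
  by (rule card_mono [OF finite_seq_count]) (use assms in auto)

lemma card_seq_set_Int:
  assumes "increasing_pos_seq f"
  shows "card (seq_set f \<inter> {..m}) = seq_count f m"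
proof -
  have "seq_set f \<inter> {..m} = f ` {n. n \<ge> 1 \<and> f n \<le> m}"
    by (auto simp: seq_set_def)
  moreover have "inj_on f {1..}"
    using assms strict_mono_on_imp_inj_on unfolding increasing_pos_seq_def by blast
  then have "inj_on f {n. n \<ge> 1 \<and> f n \<le> m}"
    by (rule inj_on_subset) auto
  ultimately show ?thesis by (simp add: seq_count_def card_image)
qed

lemma partition3_seq_count:
  assumes "increasing_pos_seq f" "increasing_pos_seq g" "increasing_pos_seq h"
    and "partition3 (seq_set f) (seq_set g) (seq_set h)"
  shows "seq_count f m + seq_count g m + seq_count h m = nat m"
proof -
  define F G H where "F = seq_set f \<inter> {..m}" and "G = seq_set g \<inter> {..m}" and "H = seq_set h \<inter> {..m}"
  have un: "F \<union> G \<union> H = {1..m}" and disj: "F \<inter> G = {}" "(F \<union> G) \<inter> H = {}"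
    using assms(4) unfolding partition3_def F_def G_def H_def by force+
  from un have "finite (F \<union> G \<union> H)" by simp
  then have fin: "finite F" "finite G" "finite H" by simp_all
  have "nat m = card (F \<union> G \<union> H)" unfolding un by simp
  also have "\<dots> = card F + card G + card H"
    using fin disj by (simp add: card_Un_disjoint)
  finally show ?thesis
    using assms(1-3) by (simp add: card_seq_set_Int F_def G_def H_def)
qed

lemma webster_le_iff:
  assumes "\<alpha> > 0"
  shows "webster \<alpha> n \<le> m \<longleftrightarrow> int n \<le> \<lfloor>\<alpha> * m + 1/2\<rfloor>"
proof -
  have "webster \<alpha> n \<le> m \<longleftrightarrow> real n - 1/2 \<le> \<alpha> * m"
    using assms by (simp add: webster_def ceiling_le_iff pos_divide_le_eq mult.commute)
  then show ?thesis by (simp add: le_floor_iff algebra_simps)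
qed

text \<open>Since \<open>\<alpha> \<le> 1\<close>, the arguments of the ceiling grow by at least 1
  from one index to the next.\<close>

lemma increasing_pos_seq_webster:
  assumes "0 < \<alpha>" "\<alpha> \<le> 1"
  shows "increasing_pos_seq (webster \<alpha>)"
  unfolding increasing_pos_seq_def
proof (intro conjI strict_mono_onI allI impI)
  fix r s :: nat assume "r < s"
  have "(real r - 1/2) / \<alpha> + 1 = (real r - 1/2 + \<alpha>) / \<alpha>"
    using assms by (simp add: add_divide_distrib)
  also have "\<dots> \<le> (real s - 1/2) / \<alpha>"
    using assms \<open>r < s\<close> by (intro divide_right_mono) auto
  finally have "(real r - 1/2) / \<alpha> + 1 \<le> (real s - 1/2) / \<alpha>" .
  then have "\<lceil>(real r - 1/2) / \<alpha> + 1\<rceil> \<le> \<lceil>(real s - 1/2) / \<alpha>\<rceil>"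
    by (rule ceiling_mono)
  then show "webster \<alpha> r < webster \<alpha> s" by (simp add: webster_def)
next
  fix n :: nat assume "1 \<le> n"
  then show "webster \<alpha> n > 0" using assms by (simp add: webster_def)
qed

text \<open>The indices counted form an initial segment; \<open>m \<ge> 0\<close> keeps its length
  from being negative, so \<open>nat\<close> loses nothing.\<close>

lemma seq_count_webster:
  assumes "\<alpha> > 0" "m \<ge> 0"
  shows "int (seq_count (webster \<alpha>) m) = \<lfloor>\<alpha> * m + 1/2\<rfloor>"
proof -
  have nn: "\<lfloor>\<alpha> * m + 1/2\<rfloor> \<ge> 0" using assms by (simp add: add_nonneg_nonneg)
  have "{n. n \<ge> 1 \<and> webster \<alpha> n \<le> m} = {1..nat \<lfloor>\<alpha> * m + 1/2\<rfloor>}"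
    using nn unfolding webster_le_iff [OF assms(1)] by (auto simp: le_nat_iff)
  then show ?thesis using nn by (simp add: seq_count_def)
qed

theorem theorem9:
  fixes \<alpha> \<beta> \<gamma> :: real
  assumes "\<alpha> > 0" "\<beta> > 0" "\<gamma> > 0"
    and "\<alpha> \<notin> \<rat>" "\<beta> \<notin> \<rat>" "\<gamma> \<notin> \<rat>"
    and "\<alpha> + \<beta> + \<gamma> = 1"
    and "\<beta> < 1/2" "\<alpha> < \<gamma>"
    and "distinct [1, \<alpha>, \<beta>]" "rat_vs.independent {1, \<alpha>, \<beta>}"
    and "\<alpha> > 1/3" "\<gamma> < 1/2"
  shows "\<not> (\<exists>b' c' :: nat \<Rightarrow> int.
            increasing_pos_seq b' \<and> increasing_pos_seq c' \<and>
            partition3 (seq_set (webster \<alpha>)) (seq_set b') (seq_set c') \<and>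
            (\<forall>n\<ge>1. c' n - webster \<gamma> n \<in> {-1, 0, 1}) \<and>
            ((\<forall>n\<ge>1. b' n - webster \<beta> n \<in> {-1, 0}) \<or>
             (\<forall>n\<ge>1. b' n - webster \<beta> n \<in> {0, 1})))"
proof
  assume "\<exists>b' c' :: nat \<Rightarrow> int.
            increasing_pos_seq b' \<and> increasing_pos_seq c' \<and>
            partition3 (seq_set (webster \<alpha>)) (seq_set b') (seq_set c') \<and>
            (\<forall>n\<ge>1. c' n - webster \<gamma> n \<in> {-1, 0, 1}) \<and>
            ((\<forall>n\<ge>1. b' n - webster \<beta> n \<in> {-1, 0}) \<or>
             (\<forall>n\<ge>1. b' n - webster \<beta> n \<in> {0, 1}))"
  then obtain b' c' where b': "increasing_pos_seq b'" and c': "increasing_pos_seq c'"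
    and part: "partition3 (seq_set (webster \<alpha>)) (seq_set b') (seq_set c')"
    and cd: "\<And>n. n \<ge> 1 \<Longrightarrow> c' n - webster \<gamma> n \<in> {-1, 0, 1}"
    and bd: "(\<forall>n\<ge>1. b' n - webster \<beta> n \<in> {-1, 0}) \<or> (\<forall>n\<ge>1. b' n - webster \<beta> n \<in> {0, 1})"
    by blast
  have inc: "increasing_pos_seq (webster \<alpha>)" "increasing_pos_seq (webster \<beta>)"
      "increasing_pos_seq (webster \<gamma>)"
    using assms(1-3,7) by (auto intro!: increasing_pos_seq_webster)
  note count = partition3_seq_count [OF inc(1) b' c' part]
  have c_le: "c' n \<le> webster \<gamma> n + 1" "webster \<gamma> n \<le> c' n + 1" if "n \<ge> 1" for n
    using cd [OF that] by auto
  \<comment> \<open>Each of \<open>\<alpha> * m\<close> and \<open>\<beta> * m\<close> will be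
    located up to an interval of length \<open>2 * \<delta>\<close>; the total slack
    \<open>4 * \<delta>\<close> is exactly the gap between \<open>\<gamma>\<close> and 1/2.\<close>
  define \<delta> where "\<delta> = (1/2 - \<gamma>) / 4"
  have \<delta>: "\<delta> > 0" "4 * \<delta> = 1/2 - \<gamma>" using assms(13) by (auto simp: \<delta>_def)
  note kron = Kronecker_pair_pos [OF assms(10,11) \<delta>(1)]
  from bd show False
  proof
    assume lower: "\<forall>n\<ge>1. b' n - webster \<beta> n \<in> {-1, 0}"
    \<comment> \<open>Centre \<open>\<delta> - 1/2\<close> and radius \<open>\<delta>\<close> put
      \<open>\<alpha> * m + 1/2\<close> between \<open>p\<close> and
      \<open>p + 2 * \<delta>\<close>, and likewise for \<open>\<beta>\<close> and
      \<open>q\<close>.\<close>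
    obtain m :: nat and p q :: int where m: "m > 0"
      and p: "\<bar>\<alpha> * m - p - (\<delta> - 1/2)\<bar> < \<delta>" and q: "\<bar>\<beta> * m - q - (\<delta> - 1/2)\<bar> < \<delta>"
      by (rule kron)
    have sum: "\<alpha> * m + \<beta> * m + \<gamma> * m = m"
      using assms(7) by (metis distrib_right mult_1)
    have "seq_count (webster \<beta>) m \<le> seq_count b' m"
      using lower by (intro seq_count_mono [OF b']) force
    moreover have "seq_count (webster \<gamma>) (int m - 1) \<le> seq_count c' m"
      using c_le by (intro seq_count_mono [OF c']) force
    moreover have "p \<le> int (seq_count (webster \<alpha>) m)"
      using p assms(1) by (simp add: seq_count_webster le_floor_iff)
    moreover have "q \<le> int (seq_count (webster \<beta>) m)"
      using q assms(2) by (simp add: seq_count_webster le_floor_iff)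
    \<comment> \<open>With the lower bounds \<open>p\<close> and \<open>q\<close>, this makes the
      three counts add up to at least \<open>m + 1\<close>.\<close>
    moreover have "of_int (int m - p - q + 1) \<le> \<gamma> * (int m - 1) + 1/2"
    proof -
      have "\<gamma> * (int m - 1) = \<gamma> * m - \<gamma>" by (simp add: right_diff_distrib)
      moreover have "\<alpha> * m < p + 2 * \<delta> - 1/2" "\<beta> * m < q + 2 * \<delta> - 1/2"
        using p q by linarith+
      moreover have "real_of_int (int m - p - q + 1) = m - p - q + 1" by simp
      ultimately show ?thesis using sum \<delta> by linarith
    qed
    then have "int m - p - q + 1 \<le> \<lfloor>\<gamma> * (int m - 1) + 1/2\<rfloor>"
      by (simp only: le_floor_iff)
    moreover have "int (seq_count (webster \<gamma>) (int m - 1)) = \<lfloor>\<gamma> * (int m - 1) + 1/2\<rfloor>"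
      by (rule seq_count_webster [OF assms(3)]) (use m in simp)
    ultimately show False using count [of "int m"] by linarith
  next
    assume upper: "\<forall>n\<ge>1. b' n - webster \<beta> n \<in> {0, 1}"
    \<comment> \<open>The mirrored centre puts the two numbers strictly below \<open>p\<close> and
      \<open>q\<close>, so their floors are at most \<open>p - 1\<close> and
      \<open>q - 1\<close>.\<close>
    obtain m :: nat and p q :: int where m: "m > 0"
      and p: "\<bar>\<alpha> * m - p - (- \<delta> - 1/2)\<bar> < \<delta>" and q: "\<bar>\<beta> * m - q - (- \<delta> - 1/2)\<bar> < \<delta>"
      by (rule kron)
    have sum: "\<alpha> * m + \<beta> * m + \<gamma> * m = m"
      using assms(7) by (metis distrib_right mult_1)
    have "seq_count b' m \<le> seq_count (webster \<beta>) m"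
      using upper by (intro seq_count_mono [OF inc(2)]) force
    moreover have "seq_count c' m \<le> seq_count (webster \<gamma>) (int m + 1)"
      using c_le by (intro seq_count_mono [OF inc(3)]) force
    moreover have "int (seq_count (webster \<alpha>) m) < p"
      using p assms(1) by (simp add: seq_count_webster floor_less_iff)
    moreover have "int (seq_count (webster \<beta>) m) < q"
      using q assms(2) by (simp add: seq_count_webster floor_less_iff)
    \<comment> \<open>The third floor is then at most \<open>m - p - q + 1\<close>, so the counts
      add up to at most \<open>m - 1\<close>.\<close>
    moreover have "\<gamma> * (int m + 1) + 1/2 < of_int (int m - p - q + 2)"
    proof -
      have "\<gamma> * (int m + 1) = \<gamma> * m + \<gamma>" by (simp add: distrib_left)
      moreover have "\<alpha> * m > p - 2 * \<delta> - 1/2" "\<beta> * m > q - 2 * \<delta> - 1/2"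
        using p q by linarith+
      moreover have "real_of_int (int m - p - q + 2) = m - p - q + 2" by simp
      ultimately show ?thesis using sum \<delta> by linarith
    qed
    then have "\<lfloor>\<gamma> * (int m + 1) + 1/2\<rfloor> < int m - p - q + 2"
      by (simp only: floor_less_iff)
    moreover have "int (seq_count (webster \<gamma>) (int m + 1)) = \<lfloor>\<gamma> * (int m + 1) + 1/2\<rfloor>"
      by (rule seq_count_webster [OF assms(3)]) simp
    ultimately show False using count [of "int m"] by linarith
  qed
qed

end
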